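(* Let $M,N,P$ be topological spaces and let $f\colon M\to N$ and $g\colon N\to P$ be continuous maps. Then $$\mathrm{IC}(f)\leq\mathrm{IC}(g\circ f)\leq \mathrm{IC}(f)\cdot\mathrm{IC}(g).$$
   Context: "Map" means continuous map. For a map $f\colon X\to Y$, the injective category number $\mathrm{IC}(f)$ is the smallest positive integer $\ell$ such that there are open subsets $U_1,\ldots,U_\ell\subset X$ with $X=U_1\cup\cdots\cup U_\ell$ and each restriction $f_{|U_j}\colon U_j\to Y$ injective; $\mathrm{IC}(f)=\infty$ if no such $\ell$ exists. A product with a factor $\infty$ is $\infty$ (all values are at least $1$). *)

theory Defs
  imports "HOL-Analysis.Abstract_Topology" "HOL-Library.Extended_Nat"
begin

definition injective_open_cover ::
    "'a topology \<Rightarrow> ('a \<Rightarrow> 'b) \<Rightarrow> nat \<Rightarrow> (nat \<Rightarrow> 'a set) \<Rightarrow> bool" where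
  "injective_open_cover X f l U \<longleftrightarrow>
     (\<forall>j\<in>{1..l}. openin X (U j)) \<and>
     topspace X = (\<Union>j\<in>{1..l}. U j) \<and>
     (\<forall>j\<in>{1..l}. inj_on f (U j))"

text \<open>
  The infimum of the empty set in \<^typ>\<open>enat\<close> is \<open>\<infinity>\<close>, so the value is \<open>\<infinity>\<close> when there is
  no such cover. The codomain is not a parameter, since injectivity does not depend on it.
  The bound \<open>l \<ge> 1\<close> matters only for the empty space, where the value is \<open>1\<close>.
\<close>

definition IC :: "'a topology \<Rightarrow> ('a \<Rightarrow> 'b) \<Rightarrow> enat" where
  "IC X f = (INF l \<in> {l. 1 \<le> l \<and> (\<exists>U. injective_open_cover X f l U)}. enat l)"

end

theory Submission
  imports Defs
begin

text \<open>If \<open>g \<circ> f\<close> is injective on a set, so is \<open>f\<close>; hence every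
  cover admissible for \<open>g \<circ> f\<close> is admissible for \<open>f\<close>, which gives
  the lower bound (\<open>IC_le_IC_comp\<close>). For the upper bound (\<open>IC_comp_le\<close>),
  take optimal covers \<open>U i\<close> of \<open>M\<close> and \<open>V j\<close> of
  \<open>N\<close> and pull the second back along \<open>f\<close>: on \<open>U i\<close>
  intersected with the preimage of \<open>V j\<close>, \<open>f\<close> is injective and lands where
  \<open>g\<close> is injective. These pairwise intersections are open and cover \<open>M\<close>.
  \<open>IC_le_card\<close> allows covers indexed by any finite nonempty set, here a set of pairs;
  \<open>IC_attained\<close> supplies the optimal covers.\<close>

lemma IC_le_card:
  assumes "finite I" and "I \<noteq> {}"
    and "\<And>i. i \<in> I \<Longrightarrow> openin X (W i)"
    and "topspace X = (\<Union>i\<in>I. W i)"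
    and "\<And>i. i \<in> I \<Longrightarrow> inj_on f (W i)"
  shows "IC X f \<le> enat (card I)"
proof -
  obtain h where "bij_betw h {1..card I} I"
    using ex_bij_betw_nat_finite_1[OF assms(1)] by blast
  then have h: "h ` {1..card I} = I"
    by (rule bij_betw_imp_surj_on)
  have "injective_open_cover X f (card I) (W \<circ> h)"
    unfolding injective_open_cover_def
  proof (intro conjI ballI)
    show "topspace X = (\<Union>j\<in>{1..card I}. (W \<circ> h) j)"
      by (simp only: assms(4) image_comp[symmetric] h)
  next
    fix j assume "j \<in> {1..card I}"
    then have "h j \<in> I"
      using h by blast
    then show "openin X ((W \<circ> h) j)" "inj_on f ((W \<circ> h) j)"
      using assms(3,5) by simp_all
  qed
  moreover have "1 \<le> card I"
    using assms(1,2) by (simp add: Suc_le_eq card_gt_0_iff)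
  ultimately show ?thesis
    unfolding IC_def by (intro INF_lower) auto
qed

text \<open>A finite infimum comes from a nonempty set of lengths, and \<open>enat\<close> is
  well-ordered, so the infimum is a minimum.\<close>

lemma IC_attained:
  assumes "IC X f = enat l"
  obtains U where "1 \<le> l" "injective_open_cover X f l U"
proof -
  let ?S = "{l. 1 \<le> l \<and> (\<exists>U. injective_open_cover X f l U)}"
  have "?S \<noteq> {}"
  proof
    assume "?S = {}"
    then have "IC X f = \<infinity>"
      unfolding IC_def by (simp only: image_empty Inf_empty top_enat_def)
    with assms show False by simp
  qed
  then obtain k where "k \<in> ?S" by blast
  then have "Inf (enat ` ?S) \<in> enat ` ?S"
    by (intro wellorder_InfI[of "enat k"] imageI)
  then have "l \<in> ?S"
    using assms unfolding IC_def by auto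
  then show thesis using that by blast
qed

lemma IC_ge_1: "1 \<le> IC X f"
  unfolding IC_def by (rule INF_greatest) (auto simp: one_enat_def)

lemma IC_le_IC_comp: "IC X f \<le> IC X (g \<circ> f)"
proof -
  have "injective_open_cover X f l U" if "injective_open_cover X (g \<circ> f) l U" for l U
    using that unfolding injective_open_cover_def by (blast intro: inj_on_imageI2)
  then show ?thesis
    unfolding IC_def by (intro INF_superset_mono) blast+
qed

lemma IC_comp_le:
  assumes f: "continuous_map M N f"
  shows "IC M (g \<circ> f) \<le> IC M f * IC N g"
proof (cases "IC M f = \<infinity> \<or> IC N g = \<infinity>")
  case True
  \<comment> \<open>In \<open>enat\<close>, \<open>0 * \<infinity> = 0\<close>, so an infinite
    factor makes the product infinite only if the other factor is nonzero.\<close>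
  have "IC M f \<noteq> 0" "IC N g \<noteq> 0"
    using IC_ge_1[of M f] IC_ge_1[of N g] by auto
  with True have "IC M f * IC N g = \<infinity>"
    by (auto simp: imult_is_infinity)
  then show ?thesis by simp
next
  case False
  then obtain l m where lm: "IC M f = enat l" "IC N g = enat m"
    by auto
  obtain U where l: "1 \<le> l" and U: "injective_open_cover M f l U"
    using IC_attained[OF lm(1)] .
  obtain V where m: "1 \<le> m" and V: "injective_open_cover N g m V"
    using IC_attained[OF lm(2)] .
  \<comment> \<open>The common refinement of the \<open>U i\<close> and the pulled-back
    \<open>V j\<close>. Empty or repeated members do no harm, since only the index pairs are
    counted.\<close>
  define W where "W = (\<lambda>(i, j). U i \<inter> {x \<in> topspace M. f x \<in> V j})"
  have "IC M (g \<circ> f) \<le> enat (card ({1..l} \<times> {1..m}))"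
  proof (rule IC_le_card)
    fix p assume p: "p \<in> {1..l} \<times> {1..m}"
    obtain i j where ij: "p = (i, j)" by (cases p)
    show "openin M (W p)"
      unfolding ij W_def prod.case
    proof (rule openin_Int)
      show "openin M (U i)"
        using p U by (simp add: ij injective_open_cover_def)
      show "openin M {x \<in> topspace M. f x \<in> V j}"
        using p V by (intro openin_continuous_map_preimage[OF f]) (simp add: ij injective_open_cover_def)
    qed
    have "inj_on f (W p)"
      using p U by (auto simp: ij W_def injective_open_cover_def intro: inj_on_subset)
    \<comment> \<open>The image of \<open>W (i, j)\<close> under \<open>f\<close> lies in
      \<open>V j\<close>.\<close>
    moreover have "inj_on g (f ` W p)"
      using p V by (auto simp: ij W_def injective_open_cover_def intro: inj_on_subset)
    ultimately show "inj_on (g \<circ> f) (W p)"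
      by (rule comp_inj_on)
  next
    show "topspace M = (\<Union>p\<in>{1..l} \<times> {1..m}. W p)"
    proof
      show "topspace M \<subseteq> (\<Union>p\<in>{1..l} \<times> {1..m}. W p)"
      proof
        fix x assume x: "x \<in> topspace M"
        \<comment> \<open>The \<open>V j\<close> cover only \<open>topspace N\<close>, so
          \<open>f x\<close> must be placed there first.\<close>
        then have "f x \<in> topspace N"
          using f by (auto simp: continuous_map_def)
        with x U V obtain i j where "i \<in> {1..l}" "x \<in> U i" "j \<in> {1..m}" "f x \<in> V j"
          unfolding injective_open_cover_def by blast
        with x show "x \<in> (\<Union>p\<in>{1..l} \<times> {1..m}. W p)"
          by (intro UN_I[of "(i, j)"]) (auto simp: W_def)
      qed
    qed (auto simp: W_def)
  qed (use l m in auto)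
  then show ?thesis
    by (simp add: lm)
qed

theorem theorem2p13:
  fixes M :: "'a topology" and N :: "'b topology" and P :: "'c topology"
    and f :: "'a \<Rightarrow> 'b" and g :: "'b \<Rightarrow> 'c"
  assumes "continuous_map M N f" and "continuous_map N P g"
  shows "IC M f \<le> IC M (g \<circ> f) \<and> IC M (g \<circ> f) \<le> IC M f * IC N g"
  using IC_le_IC_comp IC_comp_le[OF assms(1)] by blast

end
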